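(* Let $X$ be a real vector space with $\dim X>1$ and let $\tau$ be a topology on $X$. Let $\mathcal{A}_X$ be any $\rho$-admissible subset of $X$. Suppose $\mathcal{F}$ is a family of non-zero continuous linear functionals $(X,\tau)\to\mathbb{R}$ such that for any $f,g\in\mathcal{F}$, $f\neq\lambda g$ for every scalar $\lambda$ with $|\lambda|\neq 1$. Then $\perp_{(\tau,\mathcal{F},\mathcal{A}_X)}$ is right additive if and only if for each $a\in\mathcal{A}_X$ there exists at most one $f\in\mathcal{F}$ such that $f(a)=\sup_{z\in\mathcal{A}_X}|f(z)|$.
   Context: The topology $\tau$ is arbitrary; the vector space operations need not be $\tau$-continuous. Projective relation: for $u,v\in X\setminus\{0\}$, $u\,\rho\,v$ iff $u=tv$ for some non-zero $t\in\mathbb{R}$. A subset $\mathcal{A}_X\subset X$ is $\rho$-admissible if it consists of exactly one element from each equivalence class of $\rho$. For non-zero $x\in X$, $a_x$ denotes the unique element of $\mathcal{A}_X$ equivalent to $x$. Orthogonality: let $\mathcal{F}$ be a family of continuous functions $(X,\tau)\to\mathbb{R}$ (with $\mathbb{R}$ carrying the usual topology) and $\mathcal{A}_X$ a $\rho$-admissible set. For $u,v\in\mathcal{A}_X$, $u\perp_{(\tau,\mathcal{F},\mathcal{A}_X)}v$ means that there is $f\in\mathcal{F}$ with (i) $f(u)=\sup_{z\in\mathcal{A}_X}|f(z)|$ and (ii) $f(\lambda v)=0$ for all $\lambda\in\mathbb{R}$. For non-zero $x,y\in X$, $x\perp_{(\tau,\mathcal{F},\mathcal{A}_X)}y$ means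 $a_x\perp_{(\tau,\mathcal{F},\mathcal{A}_X)}a_y$. If $x=0$ or $y=0$, then $x\perp_{(\tau,\mathcal{F},\mathcal{A}_X)}y$ holds by definition. A relation $\perp$ on $X$ is right additive if for all $x,y,z\in X$, $x\perp y$ and $x\perp z$ imply $x\perp(y+z)$. *)

theory Defs
  imports "HOL-Analysis.Analysis"
begin

definition proj_rel :: "('a::real_vector \<times> 'a) set" where
  "proj_rel = {(u, v). u \<noteq> 0 \<and> v \<noteq> 0 \<and> (\<exists>t::real. t \<noteq> 0 \<and> u = t *\<^sub>R v)}"

lemma equiv_proj_rel: "equiv (UNIV - {0}) (proj_rel :: ('a::real_vector \<times> 'a) set)"
proof (rule equivI)
  show "proj_rel \<subseteq> (UNIV - {0}) \<times> (UNIV - {0::'a})"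
    by (auto simp: proj_rel_def)
  show "refl_on (UNIV - {0::'a}) proj_rel"
    by (rule refl_onI) (auto simp: proj_rel_def intro!: exI[of _ "1::real"])
  show "sym (proj_rel :: ('a \<times> 'a) set)"
  proof (rule symI)
    fix u v :: 'a assume "(u, v) \<in> proj_rel"
    then obtain t :: real where t: "u \<noteq> 0" "v \<noteq> 0" "t \<noteq> 0" "u = t *\<^sub>R v"
      by (auto simp: proj_rel_def)
    then have "v = inverse t *\<^sub>R u" "inverse t \<noteq> 0" by simp_all
    with t(1,2) show "(v, u) \<in> proj_rel"
      unfolding proj_rel_def by blast
  qed
  show "trans (proj_rel :: ('a \<times> 'a) set)"
  proof (rule transI)
    fix u v w :: 'a assume "(u, v) \<in> proj_rel" "(v, w) \<in> proj_rel"
    then obtain s t :: real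
      where "u \<noteq> 0" "w \<noteq> 0" "s \<noteq> 0" "t \<noteq> 0" "u = s *\<^sub>R v" "v = t *\<^sub>R w"
      by (auto simp: proj_rel_def)
    then show "(u, w) \<in> proj_rel"
      unfolding proj_rel_def by (auto intro!: exI[of _ "s * t"])
  qed
qed

definition rho_admissible :: "'a::real_vector set \<Rightarrow> bool" where
  "rho_admissible A \<longleftrightarrow>
     A \<subseteq> UNIV - {0} \<and> (\<forall>C \<in> (UNIV - {0}) // proj_rel. \<exists>!a. a \<in> A \<and> a \<in> C)"

text \<open>The element \<open>a\<^sub>x\<close>; meaningful only for admissible \<open>A\<close> and \<open>x \<noteq> 0\<close>.\<close>

definition rho_rep :: "'a::real_vector set \<Rightarrow> 'a \<Rightarrow> 'a" where
  "rho_rep A x = (THE a. a \<in> A \<and> (a, x) \<in> proj_rel)"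

text \<open>The supremum is taken in the extended reals: the supremum of an unbounded set of reals
  is \<open>\<infinity>\<close> and hence not attained, whereas \<open>Sup\<close> on \<open>real\<close> is
  unspecified there.\<close>

definition attains_sup_at :: "'a set \<Rightarrow> ('a \<Rightarrow> real) \<Rightarrow> 'a \<Rightarrow> bool" where
  "attains_sup_at A f u \<longleftrightarrow> ereal (f u) = (SUP z\<in>A. ereal \<bar>f z\<bar>)"

text \<open>The topology enters the orthogonality relation only through the requirement that the members
  of \<open>F\<close> be continuous, so it is not an argument of the two relations below.\<close>

definition orth_adm :: "('a::real_vector \<Rightarrow> real) set \<Rightarrow> 'a set \<Rightarrow> 'a \<Rightarrow> 'a \<Rightarrow> bool" where
  "orth_adm F A u v \<longleftrightarrow>
     (\<exists>f\<in>F. attains_sup_at A f u \<and> (\<forall>c::real. f (c *\<^sub>R v) = 0))"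

definition orth :: "('a::real_vector \<Rightarrow> real) set \<Rightarrow> 'a set \<Rightarrow> 'a \<Rightarrow> 'a \<Rightarrow> bool" where
  "orth F A x y \<longleftrightarrow> x = 0 \<or> y = 0 \<or> orth_adm F A (rho_rep A x) (rho_rep A y)"

definition right_additive :: "('a::plus \<Rightarrow> 'a \<Rightarrow> bool) \<Rightarrow> bool" where
  "right_additive R \<longleftrightarrow> (\<forall>x y z. R x y \<and> R x z \<longrightarrow> R x (y + z))"

text \<open>The library's \<open>dim\<close> is natural-valued and does not detect infinite dimension, so
  \<open>dim X > 1\<close> is expressed by the cardinality of a Hamel basis.\<close>

definition dim_gt_one :: "'a::real_vector itself \<Rightarrow> bool" where
  "dim_gt_one _ \<longleftrightarrow>
     (\<exists>B :: 'a set. independent B \<and> span B = UNIV \<and> (infinite B \<or> card B > 1))"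

end

theory Submission
  imports Defs
begin

text \<open>If \<open>f \<noteq> g\<close> in \<open>F\<close> both attain their supremum at \<open>a\<close>, then \<open>f a\<close> and \<open>g a\<close> are positive, so
  \<open>f\<close> and \<open>g\<close> are not proportional and \<open>a = y + z\<close> for some \<open>y \<in> ker f\<close>, \<open>z \<in> ker g\<close>. As \<open>a\<close> is
  orthogonal to \<open>y\<close> and to \<open>z\<close>, right additivity would make it orthogonal to itself, which is
  impossible because the members of \<open>F\<close> are non-zero. Conversely, uniqueness of the functional
  attaining its supremum at \<open>a\<close> makes the set of vectors orthogonal to \<open>a\<close> a kernel (or only
  \<open>{0}\<close>).\<close>

text \<open>Symmetry of \<open>proj_rel\<close> lets the class of \<open>x\<close> be read as the
  set of vectors related to \<open>x\<close>. This justifies the definite description in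
  \<open>rho_rep\<close>.\<close>

lemma rho_admissible_ex1:
  assumes "rho_admissible A" "x \<noteq> 0"
  shows "\<exists>!a. a \<in> A \<and> (a, x) \<in> proj_rel"
proof -
  have "proj_rel `` {x} \<in> (UNIV - {0}) // proj_rel"
    using assms(2) by (intro quotientI) auto
  moreover have "(a, x) \<in> proj_rel \<longleftrightarrow> a \<in> proj_rel `` {x}" for a
    using equiv_proj_rel by (auto elim: equivE dest: symD)
  ultimately show ?thesis
    using assms(1) unfolding rho_admissible_def by auto
qed

lemma rho_rep_mem:
  assumes "rho_admissible A" "x \<noteq> 0"
  shows "rho_rep A x \<in> A"
  using theI'[OF rho_admissible_ex1[OF assms]] unfolding rho_rep_def by blast

lemma rho_rep_scaled:
  assumes "rho_admissible A" "x \<noteq> 0"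
  obtains t :: real where "t \<noteq> 0" "rho_rep A x = t *\<^sub>R x"
  using theI'[OF rho_admissible_ex1[OF assms]]
  unfolding rho_rep_def proj_rel_def by blast

lemma rho_rep_id:
  assumes "rho_admissible A" "a \<in> A"
  shows "rho_rep A a = a"
proof -
  have "a \<noteq> 0" using assms unfolding rho_admissible_def by blast
  moreover from this have "(a, a) \<in> proj_rel"
    unfolding proj_rel_def by (auto intro!: exI[of _ 1])
  ultimately show ?thesis
    unfolding rho_rep_def using assms(2)
    by (intro the1_equality[OF rho_admissible_ex1[OF assms(1)]]) auto
qed

lemma linear_rho_rep_eq_0_iff:
  fixes f :: "'a::real_vector \<Rightarrow> real"
  assumes "rho_admissible A" "linear f" "x \<noteq> 0"
  shows "f (rho_rep A x) = 0 \<longleftrightarrow> f x = 0"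
  using rho_rep_scaled[OF assms(1,3)] linear_cmul[OF assms(2)] by (metis scaleR_eq_0_iff)

lemma attains_sup_at_ge:
  assumes "attains_sup_at A f a" "z \<in> A"
  shows "\<bar>f z\<bar> \<le> f a"
proof -
  have "ereal \<bar>f z\<bar> \<le> (SUP z\<in>A. ereal \<bar>f z\<bar>)"
    using assms(2) by (rule SUP_upper)
  then show ?thesis
    using assms(1) unfolding attains_sup_at_def by (metis ereal_less_eq(3))
qed

text \<open>Every line through the origin meets \<open>A\<close>, so a non-zero functional is
  non-zero somewhere on \<open>A\<close>, and \<open>f a\<close> bounds its absolute value
  there.\<close>

lemma attains_sup_at_pos:
  fixes f :: "'a::real_vector \<Rightarrow> real"
  assumes "rho_admissible A" "linear f" "f \<noteq> (\<lambda>x. 0)" "attains_sup_at A f a"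
  shows "f a > 0"
proof -
  obtain w where w: "f w \<noteq> 0" using assms(3) by blast
  then have "w \<noteq> 0" using linear_0[OF assms(2)] by auto
  then show ?thesis
    using attains_sup_at_ge[OF assms(4) rho_rep_mem[OF assms(1)]]
      linear_rho_rep_eq_0_iff[OF assms(1,2)] w by fastforce
qed

text \<open>A linear functional vanishes at the representative of \<open>y\<close>, and then on its
  whole line, exactly when it vanishes at \<open>y\<close>. Hence the second argument enters only
  through kernels.\<close>

lemma orth_iff:
  fixes F :: "('a::real_vector \<Rightarrow> real) set"
  assumes "rho_admissible A" "\<And>f. f \<in> F \<Longrightarrow> linear f" "x \<noteq> 0" "y \<noteq> 0"
  shows "orth F A x y \<longleftrightarrow> (\<exists>f\<in>F. attains_sup_at A f (rho_rep A x) \<and> f y = 0)"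
proof -
  have "(\<forall>c. f (c *\<^sub>R rho_rep A y) = 0) \<longleftrightarrow> f y = 0" if "f \<in> F" for f
    using linear_rho_rep_eq_0_iff[OF assms(1) assms(2)[OF that] assms(4)]
      linear_cmul[OF assms(2)[OF that]] by (metis scaleR_one scaleR_zero_right)
  then show ?thesis
    using assms(3,4) unfolding orth_def orth_adm_def by auto
qed

text \<open>Subtracting from \<open>x\<close> the multiple of \<open>a\<close> with the same value
  under \<open>f\<close> leaves a vector in the kernel of \<open>f\<close>, hence of
  \<open>g\<close>.\<close>

lemma proportional_if_kernel_subset:
  fixes f g :: "'a::real_vector \<Rightarrow> real"
  assumes "linear f" "linear g" "f a \<noteq> 0" "\<And>x. f x = 0 \<Longrightarrow> g x = 0"
  shows "g = (\<lambda>x. (g a / f a) * f x)"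
proof
  fix x
  have "f (x - (f x / f a) *\<^sub>R a) = 0"
    using assms(3) by (simp add: linear_diff[OF assms(1)] linear_cmul[OF assms(1)])
  then have "g (x - (f x / f a) *\<^sub>R a) = 0" by (rule assms(4))
  then show "g x = (g a / f a) * f x"
    by (simp add: linear_diff[OF assms(2)] linear_cmul[OF assms(2)])
qed

theorem theorem2p5:
  fixes \<tau> :: "'a::real_vector topology"
    and A :: "'a set"
    and F :: "('a \<Rightarrow> real) set"
  assumes "dim_gt_one TYPE('a)"
    and "topspace \<tau> = UNIV"
    and "rho_admissible A"
    and "\<And>f. f \<in> F \<Longrightarrow> linear f \<and> continuous_map \<tau> euclideanreal f \<and> f \<noteq> (\<lambda>x. 0)"
    and "\<And>f g c. \<lbrakk>f \<in> F; g \<in> F; \<bar>c\<bar> \<noteq> 1\<rbrakk> \<Longrightarrow> f \<noteq> (\<lambda>x. c * g x)"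
  shows "right_additive (orth F A) \<longleftrightarrow>
    (\<forall>a\<in>A. \<exists>\<^sub>\<le>\<^sub>1f. f \<in> F \<and> attains_sup_at A f a)"
proof -
  have lin: "linear f" if "f \<in> F" for f using assms(4)[OF that] by blast
  note orth_iff' = orth_iff[OF assms(3) lin]
  have pos: "f a > 0" if "f \<in> F" "attains_sup_at A f a" for f a
    using attains_sup_at_pos[OF assms(3)] assms(4) that by blast
  show ?thesis
  proof
    assume add: "right_additive (orth F A)"
    show "\<forall>a\<in>A. \<exists>\<^sub>\<le>\<^sub>1f. f \<in> F \<and> attains_sup_at A f a"
    proof (intro ballI Uniq_I, elim conjE, rule ccontr)
      fix a f g
      assume a: "a \<in> A" and f: "f \<in> F" "attains_sup_at A f a"
        and g: "g \<in> F" "attains_sup_at A g a" and "f \<noteq> g"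
      have "a \<noteq> 0" using assms(3) a unfolding rho_admissible_def by blast
      have rep: "rho_rep A a = a" using assms(3) a by (rule rho_rep_id)
      have "\<exists>w. f w = 0 \<and> g w \<noteq> 0"
      proof (rule ccontr)
        assume "\<not> (\<exists>w. f w = 0 \<and> g w \<noteq> 0)"
        then have g_eq: "g = (\<lambda>x. (g a / f a) * f x)"
          using proportional_if_kernel_subset[OF lin[OF f(1)] lin[OF g(1)]] pos[OF f] by auto
        then have "\<bar>g a / f a\<bar> = 1" using assms(5)[OF g(1) f(1)] by blast
        \<comment> \<open>Positivity of both values at \<open>a\<close> excludes the factor
          -1.\<close>
        then have "g a / f a = 1" using pos[OF f] pos[OF g] by simp
        then show False using g_eq \<open>f \<noteq> g\<close> by simp
      qed
      then obtain w where w: "f w = 0" "g w \<noteq> 0" by blast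
      \<comment> \<open>The scaling gives \<open>g y = g a\<close>, so \<open>a - y\<close> falls
        into the kernel of \<open>g\<close> while \<open>y\<close> stays in the kernel of
        \<open>f\<close>.\<close>
      define y where "y = (g a / g w) *\<^sub>R w"
      have "f y = 0" using w by (simp add: y_def linear_cmul[OF lin[OF f(1)]])
      \<comment> \<open>Unfolding \<open>orth_def\<close> settles a zero second argument, which
        \<open>orth_iff'\<close> excludes; the same happens below for \<open>a - y\<close>.\<close>
      then have "orth F A a y"
        using f orth_iff'[OF _ \<open>a \<noteq> 0\<close>] rep unfolding orth_def by metis
      moreover have "g (a - y) = 0"
        using w by (simp add: y_def linear_diff[OF lin[OF g(1)]] linear_cmul[OF lin[OF g(1)]])
      then have "orth F A a (a - y)"
        using g orth_iff'[OF _ \<open>a \<noteq> 0\<close>] rep unfolding orth_def by metis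
      ultimately have "orth F A a (y + (a - y))"
        using add unfolding right_additive_def by blast
      then obtain h where "h \<in> F" "attains_sup_at A h a" "h a = 0"
        using orth_iff'[OF _ \<open>a \<noteq> 0\<close> \<open>a \<noteq> 0\<close>] rep by auto
      then show False using pos by fastforce
    qed
  next
    assume uniq: "\<forall>a\<in>A. \<exists>\<^sub>\<le>\<^sub>1f. f \<in> F \<and> attains_sup_at A f a"
    show "right_additive (orth F A)"
      unfolding right_additive_def
    proof (intro allI impI, elim conjE)
      fix x y z
      assume xy: "orth F A x y" and xz: "orth F A x z"
      show "orth F A x (y + z)"
      \<comment> \<open>If one summand is zero, the sum is the other summand; for
        \<open>x = 0\<close> or a zero sum, orthogonality holds by definition.\<close>
      proof (cases "x = 0 \<or> y = 0 \<or> z = 0 \<or> y + z = 0")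
        case True
        then show ?thesis using xy xz by (auto simp: orth_def)
      next
        case False
        then obtain f g where f: "f \<in> F" "attains_sup_at A f (rho_rep A x)" "f y = 0"
          and g: "g \<in> F" "attains_sup_at A g (rho_rep A x)" "g z = 0"
          using xy xz orth_iff' by metis
        \<comment> \<open>Both functionals attain their supremum at the same representative of
          \<open>x\<close>.\<close>
        have "f = g"
          using uniq rho_rep_mem[OF assms(3)] False f g by (blast dest: Uniq_D)
        then have "f (y + z) = 0" using f g by (simp add: linear_add[OF lin])
        then show ?thesis using False f orth_iff' by metis
      qed
    qed
  qed
qed

end
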